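(* Let $J\ge 3$, let $\tilde{\sigma}$ be the reverse permutation of $\{1,\dots,J\}$, i.e. $\tilde{\sigma}(j)=J-j+1$ for all $j\in\{1,\dots,J\}$, and let $\tilde{P}$ be the restricted reverse permutation matrix of dimension $J-1$ (ones on the anti-diagonal, i.e. $\tilde P_{i,j}=1$ if $i+j=J$, and zeros elsewhere). Then, for every cdf $F\in\mathfrak{F}$ and every design matrix $Z\in\mathfrak{Z}$, one has the equalities of models $$(\text{adjacent},F,Z)_{\tilde{\sigma}}=(\text{adjacent},\tilde{F},-\tilde{P}Z)$$ and $$(\text{cumulative},F,Z)_{\tilde{\sigma}}=(\text{cumulative},\tilde{F},-\tilde{P}Z),$$ where $\tilde{F}(w)=1-F(-w)$.
   Context: Setting. Let $J\ge 3$ (number of categories), $p\ge 1$, and let $\mathcal{X}\subseteq\mathbb{R}^p$ be the nonempty set of values of the explanatory vector $x$. Let $\mathcal{M}=\{\pi\in\,]0,1[^{J-1} : \sum_{j=1}^{J-1}\pi_j<1\}$; for $\pi\in\mathcal{M}$ put $\pi_J=1-\sum_{j=1}^{J-1}\pi_j$ ($\pi_j$ is the probability of category $j$). Ratios. The adjacent ratio $r:\mathcal{M}\to\,]0,1[^{J-1}$ is $r_j(\pi)=\pi_j/(\pi_j+\pi_{j+1})$; the cumulative ratio is $r_j(\pi)=\pi_1+\dots+\pi_j$, for $j=1,\dots,J-1$. Each is injective on $\mathcal{M}$. Cdfs. $\mathfrak{F}$ is the set of continuous cumulative distribution functions $F$ on $\mathbb{R}$ that are strictly increasing on the open interval $I_F=\{w: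 0<F(w)<1\}$, so that $F$ maps $I_F$ bijectively onto $]0,1[$. Design matrices. The complete design matrix $Z_c(x)$ is the $(J-1)\times(J-1)(1+p)$ matrix with $Z_c(x)\beta=(\alpha_j+x^t\delta_j)_{j=1,\dots,J-1}$ for $\beta=(\alpha_1,\dots,\alpha_{J-1},\delta_1^t,\dots,\delta_{J-1}^t)^t$, $\alpha_j\in\mathbb{R}$, $\delta_j\in\mathbb{R}^p$. The set $\mathfrak{Z}$ of design matrices consists of all matrix functions $Z:x\mapsto Z_c(x)C$, where $C$ is a constant real matrix of full column rank with $q$ columns, $J-1+p\le q\le (J-1)(1+p)$. For a constant matrix $M$ of dimension $J-1$, $MZ$ denotes $x\mapsto MZ(x)$. Models. A model $(r,F,Z)$, with $Z$ having $q$ columns, has as parameter space the set of $\beta\in\mathbb{R}^q$ such that for all $x\in\mathcal{X}$, $\eta=Z(x)\beta$ satisfies $\eta\in I_F^{J-1}$ and $(F(\eta_1),\dots,F(\eta_{J-1}))\in r(\mathcal{M})$. For such $\beta$ and $x\in\mathcal{X}$, it defines the unique $\pi=\pi(x;\beta)\in\mathcal{M}$ with $r(\pi)=(F(\eta_1),\dots,F(\eta_{J-1}))^t$, $\eta=Z(x)\beta$. Permuted models. For a permutation $\sigma$ of $\{1,\dots,J\}$ and $\pi\in\mathcal{M}$, let $\pi_\sigma=(\pi_{\sigma(1)},\dots,\pi_{\sigma(J-1)})\in\mathcal{M}$. The permuted model $(r,F,Z)_\sigma$ has the same parameter space as $(r,F,Z)$ and defines $\pi=\pi(x;\beta)\in\mathcal{M}$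 by $r(\pi_\sigma)=(F(\eta_1),\dots,F(\eta_{J-1}))^t$, $\eta=Z(x)\beta$. Two (possibly permuted) models are equal if they have the same parameter space and give the same $\pi(x;\beta)$ for all $x\in\mathcal{X}$ and all $\beta$ in it. *)

theory Defs
  imports "HOL-Probability.Distribution_Functions" "Jordan_Normal_Form.DL_Rank"
begin

unbundle no vec_syntax
hide_const (open) Finite_Cartesian_Product.vec Finite_Cartesian_Product.mat
hide_type (open) Finite_Cartesian_Product.vec

(* Vectors and matrices are those of Jordan_Normal_Form, whose dimensions are terms and whose
   entries are numbered from 0.  Categories are numbered from 1 to J, so category j < J sits at
   vector position j - 1. *)

section \<open>Category probabilities and ratios\<close>

definition prob_simplex :: "nat \<Rightarrow> real vec set" where
  "prob_simplex J = {\<pi> \<in> carrier_vec (J - 1).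
     (\<forall>i<J - 1. 0 < \<pi> $ i \<and> \<pi> $ i < 1) \<and> (\<Sum>i<J - 1. \<pi> $ i) < 1}"

(* meaningful for 1 <= j <= J *)
definition cat_prob :: "nat \<Rightarrow> real vec \<Rightarrow> nat \<Rightarrow> real" where
  "cat_prob J \<pi> j = (if j = J then 1 - (\<Sum>i<J - 1. \<pi> $ i) else \<pi> $ (j - 1))"

type_synonym ratio = "nat \<Rightarrow> real vec \<Rightarrow> real vec"

definition adjacent :: ratio where
  "adjacent J \<pi> = vec (J - 1)
     (\<lambda>i. let j = i + 1 in cat_prob J \<pi> j / (cat_prob J \<pi> j + cat_prob J \<pi> (j + 1)))"

definition cumulative :: ratio where
  "cumulative J \<pi> = vec (J - 1) (\<lambda>i. let j = i + 1 in \<Sum>k=1..j. cat_prob J \<pi> k)"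

section \<open>Cumulative distribution functions\<close>

definition cdf_interval :: "(real \<Rightarrow> real) \<Rightarrow> real set" where
  "cdf_interval F = {w. 0 < F w \<and> F w < 1}"

definition cdf_class :: "(real \<Rightarrow> real) set" where
  "cdf_class = {F. (\<exists>\<mu>. real_distribution \<mu> \<and> F = cdf \<mu>) \<and>
     continuous_on UNIV F \<and> strict_mono_on (cdf_interval F) F}"

definition reflected_cdf :: "(real \<Rightarrow> real) \<Rightarrow> real \<Rightarrow> real" where
  "reflected_cdf F w = 1 - F (- w)"

section \<open>Design matrices\<close>

(* The parameter vector stacks the J - 1 intercepts and then the J - 1 slope vectors of length p;
   complete_design_mult_vec spells out the resulting linear predictors. *)
definition complete_design :: "nat \<Rightarrow> nat \<Rightarrow> real vec \<Rightarrow> real mat" where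
  "complete_design J p x = mat (J - 1) ((J - 1) * (1 + p)) (\<lambda>(i, k).
     if k < J - 1 then (if k = i then 1 else 0)
     else let l = k - (J - 1) in if l div p = i then x $ (l mod p) else 0)"

lemma complete_design_mult_vec:
  assumes "\<beta> \<in> carrier_vec ((J - 1) * (1 + p))" and i: "i < J - 1"
  shows "(complete_design J p x *\<^sub>v \<beta>) $ i =
    \<beta> $ i + (\<Sum>m<p. x $ m * \<beta> $ (J - 1 + i * p + m))"
proof -
  define n where "n = J - 1"
  define g where "g k = complete_design J p x $$ (i, k) * \<beta> $ k" for k
  have i': "i < n" using i by (simp add: n_def)
  have dim: "i * p + p \<le> n * p"
    using mult_le_mono1[of "Suc i" n p] i' by simp
  have N: "(J - 1) * (1 + p) = n + n * p" by (simp add: n_def)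
  have A: "complete_design J p x \<in> carrier_mat n (n + n * p)"
    unfolding complete_design_def N by (simp add: n_def)
  have g: "g k = (if k < n then (if k = i then 1 else 0)
     else if (k - n) div p = i then x $ ((k - n) mod p) else 0) * \<beta> $ k" if "k < n + n * p" for k
    using that i by (simp add: g_def complete_design_def n_def Let_def)
  have div: "(i * p + m) div p = i \<and> (i * p + m) mod p = m" if "m < p" for m
    using that by simp
  have "(complete_design J p x *\<^sub>v \<beta>) $ i = (\<Sum>k\<in>{0..<n + n * p}. g k)"
    using A assms(1) i' unfolding g_def N
    by (auto simp: scalar_prod_def intro!: sum.cong)
  also have "\<dots> = (\<Sum>k\<in>{0..<n}. g k) + (\<Sum>k\<in>{n..<n + n * p}. g k)"
    by (simp add: sum.atLeastLessThan_concat)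
  also have "(\<Sum>k\<in>{0..<n}. g k) = (\<Sum>k\<in>{0..<n}. if k = i then \<beta> $ k else 0)"
    by (rule sum.cong) (auto simp: g)
  also have "\<dots> = \<beta> $ i" using i' by simp
  also have "(\<Sum>k\<in>{n..<n + n * p}. g k) = (\<Sum>k\<in>(\<lambda>m. n + i * p + m) ` {..<p}. g k)"
  proof (rule sum.mono_neutral_right)
    show "(\<lambda>m. n + i * p + m) ` {..<p} \<subseteq> {n..<n + n * p}" using dim by auto
    show "\<forall>k\<in>{n..<n + n * p} - (\<lambda>m. n + i * p + m) ` {..<p}. g k = 0"
    proof
      fix k assume k: "k \<in> {n..<n + n * p} - (\<lambda>m. n + i * p + m) ` {..<p}"
      have "p > 0" using k by (cases p) auto
      have "(k - n) div p \<noteq> i"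
      proof
        assume "(k - n) div p = i"
        then have "k = n + i * p + (k - n) mod p"
          using div_mult_mod_eq[of "k - n" p] k by auto
        with k \<open>p > 0\<close> show False by (metis DiffD2 image_eqI lessThan_iff mod_less_divisor)
      qed
      with k show "g k = 0" by (simp add: g)
    qed
  qed simp
  also have "\<dots> = (\<Sum>m<p. g (n + i * p + m))"
    by (subst sum.reindex) (auto simp: inj_on_def)
  also have "\<dots> = (\<Sum>m<p. x $ m * \<beta> $ (n + i * p + m))"
  proof (rule sum.cong[OF refl])
    fix m assume "m \<in> {..<p}"
    then have "m < p" by simp
    with dim have "n + i * p + m < n + n * p" by simp
    from g[OF this] div[OF \<open>m < p\<close>]
    show "g (n + i * p + m) = x $ m * \<beta> $ (n + i * p + m)" by (simp add: add.assoc)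
  qed
  finally show ?thesis by (simp add: n_def)
qed

(* The members of the class of design matrices that have q columns.  A design matrix is a
   function on X; its values elsewhere are irrelevant. *)
definition design_class :: "nat \<Rightarrow> nat \<Rightarrow> real vec set \<Rightarrow> nat \<Rightarrow> (real vec \<Rightarrow> real mat) set" where
  "design_class J p X q = {Z. J - 1 + p \<le> q \<and> q \<le> (J - 1) * (1 + p) \<and>
     (\<exists>C \<in> carrier_mat ((J - 1) * (1 + p)) q.
        vec_space.rank ((J - 1) * (1 + p)) C = q \<and>
        (\<forall>x\<in>X. Z x = complete_design J p x * C))}"

definition const_mult :: "real mat \<Rightarrow> (real vec \<Rightarrow> real mat) \<Rightarrow> real vec \<Rightarrow> real mat" where
  "const_mult M Z x = M * Z x"

section \<open>Models\<close>

(* A model consists of its parameter space and the map taking x and \<beta> to \<pi>(x; \<beta>). *)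
type_synonym model = "real vec set \<times> (real vec \<Rightarrow> real vec \<Rightarrow> real vec)"

definition param_space ::
  "nat \<Rightarrow> real vec set \<Rightarrow> nat \<Rightarrow> ratio \<Rightarrow> (real \<Rightarrow> real) \<Rightarrow> (real vec \<Rightarrow> real mat) \<Rightarrow> real vec set" where
  "param_space J X q r F Z = {\<beta> \<in> carrier_vec q. \<forall>x\<in>X.
     let \<eta> = Z x *\<^sub>v \<beta>
     in (\<forall>i<J - 1. \<eta> $ i \<in> cdf_interval F) \<and> map_vec F \<eta> \<in> r J ` prob_simplex J}"

definition model ::
  "nat \<Rightarrow> real vec set \<Rightarrow> nat \<Rightarrow> ratio \<Rightarrow> (real \<Rightarrow> real) \<Rightarrow> (real vec \<Rightarrow> real mat) \<Rightarrow> model" where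
  "model J X q r F Z = (param_space J X q r F Z,
     \<lambda>x \<beta>. THE \<pi>. \<pi> \<in> prob_simplex J \<and> r J \<pi> = map_vec F (Z x *\<^sub>v \<beta>))"

definition permute_probs :: "nat \<Rightarrow> (nat \<Rightarrow> nat) \<Rightarrow> real vec \<Rightarrow> real vec" where
  "permute_probs J \<sigma> \<pi> = vec (J - 1) (\<lambda>i. cat_prob J \<pi> (\<sigma> (i + 1)))"

definition permuted_model ::
  "(nat \<Rightarrow> nat) \<Rightarrow> nat \<Rightarrow> real vec set \<Rightarrow> nat \<Rightarrow> ratio \<Rightarrow> (real \<Rightarrow> real) \<Rightarrow>
    (real vec \<Rightarrow> real mat) \<Rightarrow> model" where
  "permuted_model \<sigma> J X q r F Z = (param_space J X q r F Z,
     \<lambda>x \<beta>. THE \<pi>. \<pi> \<in> prob_simplex J \<and>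
       r J (permute_probs J \<sigma> \<pi>) = map_vec F (Z x *\<^sub>v \<beta>))"

definition model_eq :: "real vec set \<Rightarrow> model \<Rightarrow> model \<Rightarrow> bool" where
  "model_eq X m m' \<longleftrightarrow> fst m = fst m' \<and> (\<forall>x\<in>X. \<forall>\<beta>\<in>fst m. snd m x \<beta> = snd m' x \<beta>)"

section \<open>The reverse permutation\<close>

definition reverse_perm :: "nat \<Rightarrow> nat \<Rightarrow> nat" where
  "reverse_perm J j = (if j \<in> {1..J} then J - j + 1 else j)"

lemma reverse_perm_permutes: "reverse_perm J permutes {1..J}"
  by (rule bij_imp_permutes, rule bij_betw_byWitness[where f' = "reverse_perm J"])
     (auto simp: reverse_perm_def)

definition reverse_mat :: "nat \<Rightarrow> real mat" where
  "reverse_mat J = mat (J - 1) (J - 1) (\<lambda>(i, j). if (i + 1) + (j + 1) = J then 1 else 0)"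

end

(* Reversing the categories turns both ratios r_j into 1 - r_{J-j}, and replacing F and Z by the
   reflected cdf and -P Z does the same to the vector of the F(eta_j).  So both models impose the
   same equation on pi, whether or not it has a unique solution. *)

theory Submission
  imports Defs
begin

text \<open>Counting entries from 1, this sends v_j to 1 - v_{J-j}: for j = i + 1, index J - j sits
  at position J - 2 - i. It is the common effect of reversing the categories on the ratios and of
  reflecting \<open>F\<close> and negating and reversing the predictors.\<close>

definition reverse_complement :: "nat \<Rightarrow> real vec \<Rightarrow> real vec" where
  "reverse_complement J v = vec (J - 1) (\<lambda>i. 1 - v $ (J - 2 - i))"

lemma reverse_complement_involution:
  assumes "v \<in> carrier_vec (J - 1)"
  shows "reverse_complement J (reverse_complement J v) = v"
proof (intro eq_vecI)
  fix i assume "i < dim_vec v"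
  with assms have i: "i < J - 1" by simp
  then have "J - 2 - (J - 2 - i) = i" "J - 2 - i < J - 1" by auto
  with i show "reverse_complement J (reverse_complement J v) $ i = v $ i"
    unfolding reverse_complement_def by (simp only: index_vec)
qed (use assms in \<open>simp add: reverse_complement_def\<close>)

text \<open>Category J is by definition what the others leave of 1, so the total is 1 for an
  arbitrary vector \<open>\<pi>\<close>.\<close>

lemma sum_cat_prob:
  assumes "J \<ge> 1"
  shows "(\<Sum>k = 1..J. cat_prob J \<pi> k) = 1"
proof -
  from assms obtain n where J: "J = Suc n" by (cases J) auto
  have "(\<Sum>k = 1..n. cat_prob J \<pi> k) = (\<Sum>i<n. cat_prob J \<pi> (Suc i))"
    by (rule sum.reindex_bij_witness[of _ Suc "\<lambda>k. k - 1"]) auto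
  also have "\<dots> = (\<Sum>i<n. \<pi> $ i)"
    by (intro sum.cong) (auto simp: cat_prob_def J)
  finally show ?thesis by (simp add: J) (simp add: cat_prob_def)
qed

lemma cat_prob_pos:
  assumes "\<pi> \<in> prob_simplex J" "1 \<le> j" "j \<le> J"
  shows "cat_prob J \<pi> j > 0"
  using assms by (auto simp: prob_simplex_def cat_prob_def)

lemma sum_cat_prob_reversed:
  assumes "m \<le> J"
  shows "(\<Sum>k = 1..m. cat_prob J \<pi> (Suc J - k)) = (\<Sum>k = Suc (J - m)..J. cat_prob J \<pi> k)"
  by (rule sum.reindex_bij_witness[of _ "\<lambda>k. Suc J - k" "\<lambda>k. Suc J - k"]) (use assms in auto)

text \<open>For j < J this is a lookup. Category J of the reversed vector is not stored: it is the
  remainder left by the old categories 2 to J, and since all J of them sum to 1, that remainder is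
  the old category 1.\<close>

lemma cat_prob_permute_reverse:
  assumes "1 \<le> j" "j \<le> J"
  shows "cat_prob J (permute_probs J (reverse_perm J) \<pi>) j = cat_prob J \<pi> (Suc J - j)"
proof (cases "j = J")
  case False
  with assms show ?thesis
    by (subst cat_prob_def) (auto simp: permute_probs_def reverse_perm_def Suc_diff_le)
next
  case True
  have "(\<Sum>i<J - 1. permute_probs J (reverse_perm J) \<pi> $ i)
      = (\<Sum>i<J - 1. cat_prob J \<pi> (J - i))"
    by (intro sum.cong) (auto simp: permute_probs_def reverse_perm_def Suc_diff_Suc)
  also have "\<dots> = (\<Sum>k = 2..J. cat_prob J \<pi> k)"
    by (rule sum.reindex_bij_witness[of _ "\<lambda>k. J - k" "\<lambda>i. J - i"]) auto
  also have "\<dots> = (\<Sum>k = 1..J. cat_prob J \<pi> k) - cat_prob J \<pi> 1"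
    using assms by (simp add: sum.atLeast_Suc_atMost[of "Suc 0"] numeral_2_eq_2)
  finally show ?thesis
    using True assms sum_cat_prob[of J \<pi>] by (simp add: cat_prob_def[of J "permute_probs _ _ _"])
qed

text \<open>Positivity of all J categories is enough: for category J it says that the entries sum to
  less than 1, and a single entry is at most the sum of the positive entries.\<close>

lemma permute_reverse_in_simplex:
  assumes "\<pi> \<in> prob_simplex J" "J \<ge> 2"
  shows "permute_probs J (reverse_perm J) \<pi> \<in> prob_simplex J"
proof -
  let ?\<rho> = "permute_probs J (reverse_perm J) \<pi>"
  have pos: "cat_prob J ?\<rho> j > 0" if "1 \<le> j" "j \<le> J" for j
    using that cat_prob_permute_reverse[OF that] cat_prob_pos[OF assms(1), of "Suc J - j"] by simp
  have ent: "?\<rho> $ i > 0" if "i < J - 1" for i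
  proof -
    have "Suc i \<noteq> J" "Suc i \<le> J" using that by auto
    with pos[of "Suc i"] show ?thesis by (simp add: cat_prob_def)
  qed
  have sum: "(\<Sum>i<J - 1. ?\<rho> $ i) < 1"
    using pos[of J] assms(2) by (simp add: cat_prob_def)
  have "?\<rho> $ i < 1" if "i < J - 1" for i
    using member_le_sum[of i "{..<J - 1}" "\<lambda>i. ?\<rho> $ i"] that ent sum
    by (auto simp: less_imp_le intro: le_less_trans)
  with ent sum show ?thesis
    by (auto simp: prob_simplex_def permute_probs_def)
qed

text \<open>Ratio j after reversal compares the same two categories, J - j and J - j + 1, as ratio J
  - j before it, but with the other one in the numerator. Hence the identity a/(a+b) = 1 - b/(b+a),
  where positivity on the simplex keeps the denominator nonzero.\<close>

lemma adjacent_permute_reverse: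
  assumes "\<pi> \<in> prob_simplex J"
  shows "adjacent J (permute_probs J (reverse_perm J) \<pi>) = reverse_complement J (adjacent J \<pi>)"
proof (intro eq_vecI)
  fix i assume "i < dim_vec (reverse_complement J (adjacent J \<pi>))"
  then have i: "Suc i < J" by (simp add: reverse_complement_def)
  have idx: "Suc (J - Suc (Suc i)) = J - Suc i" "Suc (J - Suc i) = J - i" using i by auto
  have pos: "cat_prob J \<pi> (J - Suc i) > 0" "cat_prob J \<pi> (J - i) > 0"
    using i by (auto intro!: cat_prob_pos[OF assms])
  let ?\<rho> = "permute_probs J (reverse_perm J) \<pi>"
  have "adjacent J ?\<rho> $ i
      = cat_prob J ?\<rho> (Suc i) / (cat_prob J ?\<rho> (Suc i) + cat_prob J ?\<rho> (Suc (Suc i)))"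
    using i by (simp add: adjacent_def Let_def)
  also have "cat_prob J ?\<rho> (Suc i) = cat_prob J \<pi> (J - i)"
    using i by (subst cat_prob_permute_reverse) auto
  also have "cat_prob J ?\<rho> (Suc (Suc i)) = cat_prob J \<pi> (J - Suc i)"
    using i by (subst cat_prob_permute_reverse) auto
  also have "cat_prob J \<pi> (J - i) / (cat_prob J \<pi> (J - i) + cat_prob J \<pi> (J - Suc i))
      = 1 - cat_prob J \<pi> (J - Suc i) / (cat_prob J \<pi> (J - Suc i) + cat_prob J \<pi> (J - i))"
    using pos by (simp add: field_simps)
  also have "\<dots> = reverse_complement J (adjacent J \<pi>) $ i"
    using i by (simp add: reverse_complement_def adjacent_def Let_def idx)
  finally show "adjacent J (permute_probs J (reverse_perm J) \<pi>) $ i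
      = reverse_complement J (adjacent J \<pi>) $ i" .
qed (simp add: adjacent_def reverse_complement_def)

text \<open>The first j categories after reversal are the last j before it, and their total is the
  complement of the sum of the first J - j.\<close>

lemma cumulative_permute_reverse:
  "cumulative J (permute_probs J (reverse_perm J) \<pi>) = reverse_complement J (cumulative J \<pi>)"
proof (intro eq_vecI)
  fix i assume "i < dim_vec (reverse_complement J (cumulative J \<pi>))"
  then have i: "Suc i < J" by (simp add: reverse_complement_def)
  have idx: "Suc (J - Suc (Suc i)) = J - Suc i" using i by auto
  have "cumulative J (permute_probs J (reverse_perm J) \<pi>) $ i
      = (\<Sum>k = 1..Suc i. cat_prob J (permute_probs J (reverse_perm J) \<pi>) k)"
    using i by (simp add: cumulative_def)
  also have "\<dots> = (\<Sum>k = 1..Suc i. cat_prob J \<pi> (Suc J - k))"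
    using i by (intro sum.cong cat_prob_permute_reverse) auto
  also have "\<dots> = (\<Sum>k = Suc (J - Suc i)..J. cat_prob J \<pi> k)"
    using i by (intro sum_cat_prob_reversed) simp
  also have "\<dots> = 1 - (\<Sum>k = 1..J - Suc i. cat_prob J \<pi> k)"
  proof -
    \<comment> \<open>These facts let \<open>sum.ub_add_nat\<close> cut the total over 1..J after
      category J - (i + 1).\<close>
    have "J - Suc i + Suc i = J" "1 \<le> J - Suc i + 1" "1 \<le> J" using i by auto
    with sum.ub_add_nat[of 1 "J - Suc i" "cat_prob J \<pi>" "Suc i"] sum_cat_prob[of J \<pi>]
    show ?thesis by (simp only: Suc_eq_plus1) simp
  qed
  also have "\<dots> = reverse_complement J (cumulative J \<pi>) $ i"
    using i by (simp add: reverse_complement_def cumulative_def idx del: sum.cl_ivl_Suc)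
  finally show "cumulative J (permute_probs J (reverse_perm J) \<pi>) $ i
      = reverse_complement J (cumulative J \<pi>) $ i" .
qed (simp add: cumulative_def reverse_complement_def)

lemma reverse_mat_mult_vec:
  assumes "v \<in> carrier_vec (J - 1)" and i: "i < J - 1"
  shows "(reverse_mat J *\<^sub>v v) $ i = v $ (J - 2 - i)"
proof -
  have "(reverse_mat J *\<^sub>v v) $ i = (\<Sum>k\<in>{0..<J - 1}. (if (i + 1) + (k + 1) = J then 1 else 0) * v $ k)"
    using assms by (simp add: reverse_mat_def scalar_prod_def)
  also have "\<dots> = (\<Sum>k\<in>{0..<J - 1}. if k = J - 2 - i then v $ k else 0)"
    using i by (intro sum.cong) auto
  also have "\<dots> = v $ (J - 2 - i)" using i by simp
  finally show ?thesis .
qed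

lemma const_mult_reverse_mat_mult_vec:
  assumes "Z x \<in> carrier_mat (J - 1) q" "\<beta> \<in> carrier_vec q"
  shows "const_mult (- reverse_mat J) Z x *\<^sub>v \<beta>
    = vec (J - 1) (\<lambda>i. - ((Z x *\<^sub>v \<beta>) $ (J - 2 - i)))"
proof -
  have R: "reverse_mat J \<in> carrier_mat (J - 1) (J - 1)" by (simp add: reverse_mat_def)
  have e: "Z x *\<^sub>v \<beta> \<in> carrier_vec (J - 1)" using assms by simp
  have "const_mult (- reverse_mat J) Z x *\<^sub>v \<beta> = (- reverse_mat J) *\<^sub>v (Z x *\<^sub>v \<beta>)"
    unfolding const_mult_def using R assms by (intro assoc_mult_mat_vec) auto
  also have "\<dots> = - (reverse_mat J *\<^sub>v (Z x *\<^sub>v \<beta>))"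
    using R carrier_vecD[OF e] by (intro uminus_mult_mat_vec) simp
  also have "\<dots> = vec (J - 1) (\<lambda>i. - ((Z x *\<^sub>v \<beta>) $ (J - 2 - i)))"
    \<comment> \<open>With \<open>index_mult_mat_vec\<close> removed, an entry of the product stays
      intact for \<open>reverse_mat_mult_vec\<close> instead of unfolding to a scalar
      product.\<close>
    using R reverse_mat_mult_vec[OF e]
    by (intro eq_vecI) (auto simp del: index_mult_mat_vec simp: index_uminus_vec)
  finally show ?thesis .
qed

lemma reflected_cdf_interval:
  "- w \<in> cdf_interval (reflected_cdf F) \<longleftrightarrow> w \<in> cdf_interval F"
  by (auto simp: cdf_interval_def reflected_cdf_def)

text \<open>The minus sign on the predictor cancels the one inside \<open>reflected_cdf\<close>,
  leaving 1 - F at the mirrored position.\<close>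

lemma map_reflected_cdf:
  assumes "v \<in> carrier_vec (J - 1)"
  shows "map_vec (reflected_cdf F) (vec (J - 1) (\<lambda>i. - (v $ (J - 2 - i))))
    = reverse_complement J (map_vec F v)"
  using assms by (intro eq_vecI) (auto simp: reverse_complement_def reflected_cdf_def)

lemma design_class_carrier:
  assumes "Z \<in> design_class J p X q" "x \<in> X"
  shows "Z x \<in> carrier_mat (J - 1) q"
  using assms by (auto simp: design_class_def complete_design_def)

text \<open>The map i -> J - 2 - i is its own inverse on the positions below J - 1.\<close>

lemma all_reversed_iff:
  "(\<forall>i<J - 1. P (J - 2 - i)) \<longleftrightarrow> (\<forall>i<J - 1. P i)" for J :: nat
proof (intro iffI allI impI)
  fix i assume *: "\<forall>i<J - 1. P (J - 2 - i)" and "i < J - 1"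
  then have "J - 2 - (J - 2 - i) = i" "J - 2 - i < J - 1" by auto
  with * show "P i" by metis
qed auto

text \<open>The ratio enters through \<open>dim\<close> and \<open>rev\<close> alone, so one
  argument serves both equalities.\<close>

lemma model_eq_reverse:
  assumes J: "J \<ge> 2"
    and Z: "\<And>x. x \<in> X \<Longrightarrow> Z x \<in> carrier_mat (J - 1) q"
    and dim: "\<And>\<pi>. r J \<pi> \<in> carrier_vec (J - 1)"
    and rev: "\<And>\<pi>. \<pi> \<in> prob_simplex J \<Longrightarrow>
      r J (permute_probs J (reverse_perm J) \<pi>) = reverse_complement J (r J \<pi>)"
  shows "model_eq X (permuted_model (reverse_perm J) J X q r F Z)
    (model J X q r (reflected_cdf F) (const_mult (- reverse_mat J) Z))"
proof -
  let ?Z' = "const_mult (- reverse_mat J) Z"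
  have eta: "?Z' x *\<^sub>v \<beta> = vec (J - 1) (\<lambda>i. - ((Z x *\<^sub>v \<beta>) $ (J - 2 - i)))"
    and F_eta: "map_vec (reflected_cdf F) (?Z' x *\<^sub>v \<beta>)
      = reverse_complement J (map_vec F (Z x *\<^sub>v \<beta>))"
    and carrier: "map_vec F (Z x *\<^sub>v \<beta>) \<in> carrier_vec (J - 1)"
    if "x \<in> X" "\<beta> \<in> carrier_vec q" for x \<beta>
  proof -
    show 1: "?Z' x *\<^sub>v \<beta> = vec (J - 1) (\<lambda>i. - ((Z x *\<^sub>v \<beta>) $ (J - 2 - i)))"
      using Z that by (intro const_mult_reverse_mat_mult_vec) auto
    show "map_vec (reflected_cdf F) (?Z' x *\<^sub>v \<beta>)
        = reverse_complement J (map_vec F (Z x *\<^sub>v \<beta>))"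
      unfolding 1 using Z[OF that(1)] that(2) by (intro map_reflected_cdf) simp
    show "map_vec F (Z x *\<^sub>v \<beta>) \<in> carrier_vec (J - 1)"
      using Z[OF that(1)] that(2) by simp
  qed
  have closed: "reverse_complement J v \<in> r J ` prob_simplex J" if "v \<in> r J ` prob_simplex J" for v
  proof -
    \<comment> \<open>If \<open>\<pi>\<close> has ratio \<open>v\<close>, then by \<open>rev\<close>
      the reversed \<open>\<pi>\<close>, again in the simplex, has the complemented ratio.\<close>
    from that obtain \<pi> where \<pi>: "\<pi> \<in> prob_simplex J" "v = r J \<pi>" by blast
    show ?thesis
      unfolding \<pi>(2) rev[OF \<pi>(1), symmetric]
      by (intro imageI permute_reverse_in_simplex \<pi>(1) J)
  qed
  have range_iff: "reverse_complement J v \<in> r J ` prob_simplex J \<longleftrightarrow> v \<in> r J ` prob_simplex J"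
    if "v \<in> carrier_vec (J - 1)" for v
    \<comment> \<open>The converse is \<open>closed\<close> at the complement of \<open>v\<close>,
      whose own complement is \<open>v\<close> again.\<close>
    using closed[of v] closed[of "reverse_complement J v"] reverse_complement_involution[OF that]
    by auto
  have interval_iff: "(\<forall>i<J - 1. (?Z' x *\<^sub>v \<beta>) $ i \<in> cdf_interval (reflected_cdf F))
      \<longleftrightarrow> (\<forall>i<J - 1. (Z x *\<^sub>v \<beta>) $ i \<in> cdf_interval F)"
    if "x \<in> X" "\<beta> \<in> carrier_vec q" for x \<beta>
    using all_reversed_iff[of J "\<lambda>i. (Z x *\<^sub>v \<beta>) $ i \<in> cdf_interval F"]
    unfolding eta[OF that] by (simp add: reflected_cdf_interval)
  have "param_space J X q r F Z = param_space J X q r (reflected_cdf F) ?Z'"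
    unfolding param_space_def Let_def
    \<comment> \<open>The congruence rules supply the memberships of \<open>x\<close> and
      \<open>\<beta>\<close> on which the three rewrites are conditional.\<close>
    by (intro Collect_cong conj_cong ball_cong refl)
      (simp_all only: interval_iff F_eta range_iff[OF carrier])
  \<comment> \<open>By \<open>rev\<close> the left equation has \<open>reverse_complement\<close>
    applied to the ratio, the right one to the values of \<open>F\<close>; the involution moves it
    across. The two \<open>THE\<close> terms thus describe the same predicate.\<close>
  moreover have "(\<pi> \<in> prob_simplex J \<and>
        r J (permute_probs J (reverse_perm J) \<pi>) = map_vec F (Z x *\<^sub>v \<beta>))
      \<longleftrightarrow> (\<pi> \<in> prob_simplex J \<and> r J \<pi> = map_vec (reflected_cdf F) (?Z' x *\<^sub>v \<beta>))"
    if "x \<in> X" "\<beta> \<in> carrier_vec q" for x \<beta> \<pi>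
    using rev[of \<pi>] reverse_complement_involution[OF carrier[OF that]]
      reverse_complement_involution[OF dim[of \<pi>]]
    unfolding F_eta[OF that] by auto
  moreover have "\<beta> \<in> carrier_vec q" if "\<beta> \<in> param_space J X q r F Z" for \<beta>
    using that by (simp add: param_space_def)
  ultimately show ?thesis
    by (simp add: model_eq_def permuted_model_def model_def)
qed

theorem mainTheorem11:
  fixes J p q :: nat
    and X :: "real vec set"
    and F :: "real \<Rightarrow> real"
    and Z :: "real vec \<Rightarrow> real mat"
  assumes "J \<ge> 3"
    and "p \<ge> 1"
    and "X \<subseteq> carrier_vec p"
    and "X \<noteq> {}"
    and "F \<in> cdf_class"
    and "Z \<in> design_class J p X q"
  shows "model_eq X
           (permuted_model (reverse_perm J) J X q adjacent F Z)
           (model J X q adjacent (reflected_cdf F) (const_mult (- reverse_mat J) Z)) \<and>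
         model_eq X
           (permuted_model (reverse_perm J) J X q cumulative F Z)
           (model J X q cumulative (reflected_cdf F) (const_mult (- reverse_mat J) Z))"
proof -
  have *: "model_eq X (permuted_model (reverse_perm J) J X q r F Z)
      (model J X q r (reflected_cdf F) (const_mult (- reverse_mat J) Z))"
    if "\<And>\<pi>. r J \<pi> \<in> carrier_vec (J - 1)"
      "\<And>\<pi>. \<pi> \<in> prob_simplex J \<Longrightarrow>
        r J (permute_probs J (reverse_perm J) \<pi>) = reverse_complement J (r J \<pi>)" for r
    using assms that by (intro model_eq_reverse) (auto dest: design_class_carrier)
  show ?thesis
    by (intro conjI *)
      \<comment> \<open>The reversal lemmas apply while the ratios are still folded; unfolding the
        ratios afterwards settles the dimension goals.\<close>
      (simp_all add: adjacent_permute_reverse cumulative_permute_reverse,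
        simp_all add: adjacent_def cumulative_def)
qed

end
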